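(* Let $1\le k\le n-1$, $\gcd(k,n)=1$ with $k$ odd, and let $\psi=\operatorname{MCM}^{-1}$ be the inverse of the permutation $\operatorname{MCM}$ of $\mathbb{F}_{2^n}$. For $\rho\in\mathbb{F}_{2^n}\setminus\{0,1\}$ and $\sigma=1+\rho$ define $$A(\rho):=\sum_{\substack{(t_1,t_2,t_3)\in\mathbb{F}_{2^n}^3\\ t_1+\rho t_2+\sigma t_3=0}}\chi\bigl(\psi(t_1)+\psi(t_2)+\psi(t_3)\bigr)=\sum_{t,a\in\mathbb{F}_{2^n}}\chi\bigl(\psi(t+\rho a)+\psi(t+a)+\psi(t)\bigr)$$ (the two expressions being equal). Then $8\,Z(\rho)=2^{n}A(\rho)$, and the statement "$N(v_1,v_2)=2^{2n-3}$ for all distinct nonzero $v_1,v_2\in\mathbb{F}_{2^n}$" is equivalent to $$A(\rho)=0\quad\text{for all }\rho\in\mathbb{F}_{2^n}\setminus\{0,1\}.$$ Equivalently, in Fourier form, with $$W_\psi(1,\mu)=\sum_{x\in\mathbb{F}_{2^n}}\chi(\psi(x)+\mu x)=W_{\operatorname{MCM}}(\mu,1)=2S(\mu),$$ one has $$A(\rho)=2^{-n}\sum_{\mu\in\mathbb{F}_{2^n}}W_\psi(1,\mu)\,W_\psi(1,\mu\rho)\,W_\psi(1,\mu\sigma).$$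
   Context: $\mathbb{F}_{2^n}$ is the field with $2^n$ elements, $\operatorname{Tr}(x)=\sum_{i=0}^{n-1}x^{2^i}$ is the absolute trace, and $\chi(x)=(-1)^{\operatorname{Tr}(x)}$. Put $q=2^k$, $F(x)=x^{4^k-2^k+1}$, $\delta(b)=F(b)+F(b+1)+1$, $\Delta=\{\delta(b): b\in\mathbb{F}_{2^n}\}$, and $S(a)=\sum_{t\in\Delta}\chi(at)$. For distinct nonzero $v_1,v_2\in\mathbb{F}_{2^n}$, $N(v_1,v_2)=|\{(x,y,z)\in\Delta^3: v_1x+v_2y+(v_1+v_2)z=0\}|$. For $\rho\in\mathbb{F}_{2^n}\setminus\{0,1\}$ and $\sigma=1+\rho$, $Z(\rho)=\sum_{\lambda\in\mathbb{F}_{2^n}^{*}}S(\lambda)S(\lambda\rho)S(\lambda\sigma)$. Let $T_k(x)=\sum_{i=0}^{k-1}x^{2^i}$ and let $\operatorname{MCM}(x)=T_k(x)^{q+1}/x^{q}$ be the Müller–Cohen–Matthews polynomial; since $x^q$ divides $T_k(x)^q$ this is a polynomial, and $\operatorname{MCM}(0)=0$. It is a known result (Cohen–Matthews) that for $k$ odd, $\gcd(k,n)=1$, $1\le k<n$, the map $\operatorname{MCM}$ is a permutation of $\mathbb{F}_{2^n}$. Its Walsh coefficient is $W_{\operatorname{MCM}}(\mu,1)=\sum_{y\in\mathbb{F}_{2^n}}\chi(\mu\operatorname{MCM}(y)+y)$.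
   Formalization: The equality W_MCM(μ,1) = 2S(μ) is stated only for μ ≠ 0, since at μ = 0 it is false: W_MCM(0,1) = 0 while 2S(0) = 2|Δ| = 2^n; the equality W_ψ(1,μ) = W_MCM(μ,1) is kept for all μ. *)

theory Defs
  imports Complex_Main "HOL-Library.Cardinality"
begin

text \<open>
  The field with \<open>2 ^ n\<close> elements is an arbitrary type \<open>'a :: {field, finite}\<close> with
  \<open>CARD('a) = 2 ^ n\<close>; such a field necessarily has characteristic 2, so in particular
  \<open>- x = x\<close>. The exponent \<open>n\<close> is passed explicitly to the definitions that depend on it.
\<close>

definition abs_trace :: "nat \<Rightarrow> 'a::field \<Rightarrow> 'a" where
  "abs_trace n x = (\<Sum>i<n. x ^ (2 ^ i))"

text \<open>
  The trace takes its values in the prime field \<open>{0, 1}\<close> of \<open>'a\<close>, so the case distinction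
  is \<open>(-1)\<close> to the power of the trace.
\<close>

definition chi :: "nat \<Rightarrow> 'a::field \<Rightarrow> real" where
  "chi n x = (if abs_trace n x = 0 then 1 else - 1)"

definition kasami :: "nat \<Rightarrow> 'a::field \<Rightarrow> 'a" where
  "kasami k x = x ^ (4 ^ k - 2 ^ k + 1)"

definition kasami_delta :: "nat \<Rightarrow> 'a::field \<Rightarrow> 'a" where
  "kasami_delta k b = kasami k b + kasami k (b + 1) + 1"

definition Delta :: "nat \<Rightarrow> 'a::field set" where
  "Delta k = range (kasami_delta k)"

definition S_sum :: "nat \<Rightarrow> nat \<Rightarrow> 'a::field \<Rightarrow> real" where
  "S_sum n k a = (\<Sum>t\<in>Delta k. chi n (a * t))"

definition N_count :: "nat \<Rightarrow> 'a::field \<Rightarrow> 'a \<Rightarrow> nat" where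
  "N_count k v1 v2 =
     card {(x, y, z). x \<in> Delta k \<and> y \<in> Delta k \<and> z \<in> Delta k \<and>
                      v1 * x + v2 * y + (v1 + v2) * z = 0}"

definition Z_sum :: "nat \<Rightarrow> nat \<Rightarrow> 'a::field \<Rightarrow> real" where
  "Z_sum n k \<rho> =
     (\<Sum>l | l \<noteq> 0. S_sum n k l * S_sum n k (l * \<rho>) * S_sum n k (l * (1 + \<rho>)))"

definition T_poly :: "nat \<Rightarrow> 'a::field \<Rightarrow> 'a" where
  "T_poly k x = (\<Sum>i<k. x ^ (2 ^ i))"

text \<open>
  The polynomial function of Mueller, Cohen and Matthews. At \<open>x = 0\<close> the polynomial
  \<open>T_k(X) ^ (q + 1) / X ^ q\<close> vanishes, in agreement with the convention \<open>y / 0 = 0\<close>.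
\<close>

definition MCM :: "nat \<Rightarrow> 'a::field \<Rightarrow> 'a" where
  "MCM k x = T_poly k x ^ (2 ^ k + 1) / x ^ (2 ^ k)"

text \<open>
  \<open>inv\<close> is the genuine two-sided inverse whenever \<open>MCM k\<close> is a permutation, which is the
  case for \<open>k\<close> odd and coprime to \<open>n\<close> (Cohen and Matthews).
\<close>

definition MCM_inv :: "nat \<Rightarrow> 'a::field \<Rightarrow> 'a" where
  "MCM_inv k = inv (MCM k)"

definition walsh :: "nat \<Rightarrow> ('a::field \<Rightarrow> 'a) \<Rightarrow> 'a \<Rightarrow> 'a \<Rightarrow> real" where
  "walsh n f a b = (\<Sum>x\<in>UNIV. chi n (a * f x + b * x))"

definition A_sum :: "nat \<Rightarrow> nat \<Rightarrow> 'a::field \<Rightarrow> real" where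
  "A_sum n k \<rho> =
     (\<Sum>(t1, t2, t3)\<in>{(t1, t2, t3). t1 + \<rho> * t2 + (1 + \<rho>) * t3 = 0}.
        chi n (MCM_inv k t1 + MCM_inv k t2 + MCM_inv k t3))"

end

theory Submission
  imports Defs "HOL-Computational_Algebra.Polynomial"
begin

text \<open>
  With \<open>q = 2 ^ k\<close> one has \<open>T_k(b\<^sup>2 + b) = b ^ q + b\<close>, and clearing denominators in the Kasami power
  gives \<open>\<delta>(b) = MCM(b\<^sup>2 + b)\<close>. By Hilbert 90 the elements \<open>b\<^sup>2 + b\<close> are exactly those of trace zero,
  so \<open>\<Delta>\<close> is the image of the trace-zero hyperplane under \<open>MCM\<close>. Since \<open>MCM\<close> is a permutation,
  writing the indicator of the hyperplane as \<open>(1 + \<chi>) / 2\<close> gives \<open>W(\<mu>, 1) = 2 S(\<mu>)\<close> for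
  \<open>\<mu> \<noteq> 0\<close>, while \<open>W(0, 1) = 0\<close>. The rest is orthogonality of characters.

  The Cohen-Matthews theorem is proved by showing directly that two nonzero preimages \<open>x, x'\<close> of
  the same value \<open>e ^ q\<close> agree. Taking \<open>q\<close>-th roots \<open>u, u + v\<close> of \<open>T_k(x)\<close>, \<open>T_k(x')\<close>, the elements
  \<open>g = (u ^ q v + u v ^ q) / e\<close> and \<open>h = v ^ (q + 1) / e\<close> satisfy \<open>x' = x + g + h\<close> and
  \<open>h + g\<^sup>2 \<in> {0, 1}\<close>. Each of the two values is incompatible with the equations for \<open>T_k\<close>.
\<close>

section \<open>Arithmetic in characteristic two\<close>

locale binary_field =
  fixes ty :: "'a::{field, finite} itself" and n :: nat
  assumes card_field: "CARD('a) = 2 ^ n" and n_pos: "0 < n"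
begin

text \<open>Translation by 1 permutes the field, so comparing the sums of all elements makes the
  field size, a power of 2, vanish in \<open>'a\<close>.\<close>

lemma two_eq_zero: "(2::'a) = 0"
proof -
  have "(\<Sum>y\<in>(UNIV::'a set). y) = (\<Sum>y\<in>UNIV. 1 + y)"
    by (rule sum.reindex_bij_witness[of _ "\<lambda>y. 1 + y" "\<lambda>y. y - 1"]) auto
  then have "of_nat (CARD('a)) = (0::'a)"
    by (simp add: sum.distrib)
  then show ?thesis
    by (simp add: card_field)
qed

lemma add_self [simp]: "x + x = (0::'a)"
  by (metis mult_2 mult_zero_left two_eq_zero)

lemma add_self_left [simp]: "x + (x + y) = (y::'a)"
  by (simp flip: add.assoc)

lemma add_eq_zero_iff: "x + y = 0 \<longleftrightarrow> x = (y::'a)"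
  by (metis add_self add_self_left add.right_neutral)

subsection \<open>Frobenius powers and truncated traces\<close>

lemma frobenius_add: "(x + y) ^ 2 ^ k = x ^ 2 ^ k + (y::'a) ^ 2 ^ k"
proof (induction k)
  case (Suc k)
  have "(x + y) ^ 2 ^ Suc k = ((x + y) ^ 2 ^ k)\<^sup>2"
    by (simp add: power_mult mult.commute flip: power_mult)
  also have "\<dots> = x ^ 2 ^ Suc k + y ^ 2 ^ Suc k"
    by (simp add: Suc.IH power2_sum two_eq_zero mult.commute flip: power_mult)
  finally show ?case .
qed simp

lemma square_add: "(x + y)\<^sup>2 = x\<^sup>2 + (y::'a)\<^sup>2"
  using frobenius_add[of x y 1] by simp

lemma frobenius_eq_iff: "x ^ 2 ^ k = (y::'a) ^ 2 ^ k \<longleftrightarrow> x = y"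
proof
  assume "x ^ 2 ^ k = y ^ 2 ^ k"
  then have "(x + y) ^ 2 ^ k = 0"
    by (simp add: frobenius_add)
  then show "x = y"
    by (simp add: add_eq_zero_iff)
qed simp

lemma frobenius_surj: "\<exists>y. (y::'a) ^ 2 ^ k = x"
proof -
  have "surj (\<lambda>y::'a. y ^ 2 ^ k)"
    by (intro finite_UNIV_inj_surj injI) (simp_all add: frobenius_eq_iff)
  then show ?thesis
    by (metis surjD)
qed

lemma power_card: "(x::'a) ^ 2 ^ n = x"
proof (cases "x = 0")
  case False
  let ?P = "\<Prod>y\<in>UNIV - {0::'a}. y"
  have "?P = (\<Prod>y\<in>UNIV - {0}. x * y)"
    by (rule prod.reindex_bij_witness[of _ "\<lambda>y. x * y" "\<lambda>y. y / x"]) (use False in auto)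
  also have "\<dots> = x ^ (CARD('a) - 1) * ?P"
    by (simp add: prod.distrib)
  finally have "x ^ (2 ^ n - 1) = 1"
    by (simp add: card_field)
  moreover have "(2::nat) ^ n = Suc (2 ^ n - 1)"
    by simp
  ultimately show ?thesis
    by (metis mult.right_neutral power_Suc)
qed simp

text \<open>By Bezout some iterate of \<open>x \<mapsto> x ^ 2 ^ k\<close> is squaring, because
  \<open>x ^ 2 ^ n = x\<close>. A fixed point therefore satisfies
  \<open>x\<^sup>2 = x\<close>.\<close>

lemma frobenius_fixed:
  assumes "gcd k n = 1" "1 \<le> k" and fixed: "(x::'a) ^ 2 ^ k = x"
  shows "x = 0 \<or> x = 1"
proof -
  have iter: "x ^ 2 ^ (j * m) = x" if "x ^ 2 ^ j = x" for j m
  proof (induction m)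
    case (Suc m)
    have "x ^ 2 ^ (j * Suc m) = (x ^ 2 ^ j) ^ 2 ^ (j * m)"
      by (simp add: power_add flip: power_mult)
    with Suc that show ?case
      by simp
  qed simp
  obtain a b where ab: "k * a = n * b + 1"
    using bezout_nat[of k n] assms by auto
  have "x\<^sup>2 = (x ^ 2 ^ (n * b))\<^sup>2"
    by (simp add: iter power_card)
  also have "\<dots> = x ^ 2 ^ (k * a)"
    by (simp only: ab power_add power_one_right power_mult)
  also have "\<dots> = x"
    using iter fixed .
  finally show ?thesis
    by (simp add: power2_eq_square)
qed

lemma T_poly_add: "T_poly k (x + y) = T_poly k x + T_poly k (y::'a)"
  by (simp add: T_poly_def frobenius_add sum.distrib)

text \<open>The sum telescopes in characteristic 2.\<close>

lemma T_poly_artin_schreier: "T_poly k (y\<^sup>2 + y) = y ^ 2 ^ k + (y::'a)"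
proof (induction k)
  case (Suc k)
  have "T_poly (Suc k) (y\<^sup>2 + y) = T_poly k (y\<^sup>2 + y) + (y\<^sup>2 + y) ^ 2 ^ k"
    by (simp add: T_poly_def)
  with Suc show ?case
    by (simp add: frobenius_add ac_simps flip: power_mult)
qed (simp add: T_poly_def)

lemma T_poly_square: "T_poly k (x\<^sup>2) = (T_poly k (x::'a))\<^sup>2"
proof -
  have "(\<Sum>i\<in>I. f i)\<^sup>2 = (\<Sum>i\<in>I. (f i)\<^sup>2)" for f :: "nat \<Rightarrow> 'a" and I
    by (induction I rule: infinite_finite_induct) (simp_all add: square_add)
  then show ?thesis
    by (simp add: T_poly_def mult.commute flip: power_mult)
qed

lemma T_poly_square_add: "(T_poly k x)\<^sup>2 + T_poly k x = x ^ 2 ^ k + (x::'a)"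
  by (metis T_poly_add T_poly_artin_schreier T_poly_square)

text \<open>This is where the parity of \<open>k\<close> enters: the value is a sum of
  \<open>k\<close> ones.\<close>

lemma T_poly_one:
  assumes "odd k"
  shows "T_poly k (1::'a) = 1"
proof -
  obtain m where "k = 2 * m + 1"
    using assms by (elim oddE)
  then show ?thesis
    by (simp add: T_poly_def two_eq_zero)
qed

lemma T_poly_nonzero:
  assumes "gcd k n = 1" "odd k" "(x::'a) \<noteq> 0"
  shows "T_poly k x \<noteq> 0"
proof
  assume "T_poly k x = 0"
  then have "x ^ 2 ^ k = x"
    using T_poly_square_add[of k x] by (simp add: add_eq_zero_iff)
  with assms have "x = 1"
    using frobenius_fixed[of k x] odd_pos[of k] by auto
  with \<open>T_poly k x = 0\<close> T_poly_one[OF \<open>odd k\<close>] show False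
    by simp
qed

subsection \<open>The permutation property of \<open>MCM\<close>\<close>

text \<open>
  A nonzero solution \<open>x\<close> of \<open>MCM x = e ^ q\<close> is \<open>u ^ (q + 1) / e\<close> with \<open>u ^ q = T_k x\<close>. Then
  \<open>T_k(x)\<^sup>2 + T_k(x) = x ^ q + x\<close> becomes an affine equation for \<open>u\<close>; here \<open>f = 1 / e\<close>.
\<close>

lemma MCM_param:
  assumes "gcd k n = 1" "odd k" "(x::'a) \<noteq> 0" "MCM k x = e ^ 2 ^ k" "e \<noteq> 0"
  obtains u f where "f = inverse e" "T_poly k x = u ^ 2 ^ k" "x = u * u ^ 2 ^ k * f"
    "(u ^ 2 ^ k) ^ 2 ^ k * f ^ 2 ^ k + u ^ 2 ^ k + u * f = 1"
proof -
  define f where "f = inverse e"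
  obtain u where u: "u ^ 2 ^ k = T_poly k x"
    using frobenius_surj by blast
  have "u ^ 2 ^ k \<noteq> 0"
    using T_poly_nonzero assms u by metis
  have "T_poly k x ^ (2 ^ k + 1) = (e * x) ^ 2 ^ k"
    using assms by (simp add: MCM_def divide_simps power_mult_distrib)
  moreover have "T_poly k x ^ (2 ^ k + 1) = (u * u ^ 2 ^ k) ^ 2 ^ k"
    by (simp only: flip: u) (simp add: power_mult_distrib)
  ultimately have "e * x = u * u ^ 2 ^ k"
    by (metis frobenius_eq_iff)
  then have x: "x = u * u ^ 2 ^ k * f"
    using \<open>e \<noteq> 0\<close> by (simp add: f_def field_simps)
  have "(u ^ 2 ^ k)\<^sup>2 + u ^ 2 ^ k = (u * u ^ 2 ^ k * f) ^ 2 ^ k + u * u ^ 2 ^ k * f"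
    unfolding x[symmetric] unfolding u by (rule T_poly_square_add)
  \<comment> \<open>Every term contains the nonzero factor \<open>u ^ 2 ^ k\<close>; cancelling it
    leaves the affine equation.\<close>
  then have "u ^ 2 ^ k * (u ^ 2 ^ k + 1)
      = u ^ 2 ^ k * ((u ^ 2 ^ k) ^ 2 ^ k * f ^ 2 ^ k + u * f)"
    by (simp add: power_mult_distrib power2_eq_square algebra_simps)
  with \<open>u ^ 2 ^ k \<noteq> 0\<close> have "u ^ 2 ^ k + 1 = (u ^ 2 ^ k) ^ 2 ^ k * f ^ 2 ^ k + u * f"
    by (metis mult_left_cancel)
  then have "(u ^ 2 ^ k) ^ 2 ^ k * f ^ 2 ^ k + u ^ 2 ^ k + u * f = u ^ 2 ^ k + (u ^ 2 ^ k + 1)"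
    by (simp add: ac_simps)
  then have "(u ^ 2 ^ k) ^ 2 ^ k * f ^ 2 ^ k + u ^ 2 ^ k + u * f = 1"
    by simp
  with that f_def u x show thesis
    by metis
qed

lemma MCM_inj_nonzero:
  assumes k: "gcd k n = 1" "odd k" and x: "(x::'a) \<noteq> 0" and x': "x' \<noteq> 0"
    and eq: "MCM k x = MCM k x'"
  shows "x = x'"
proof (rule ccontr)
  assume "x \<noteq> x'"
  obtain e where e: "e ^ 2 ^ k = MCM k x"
    using frobenius_surj by blast
  have "e \<noteq> 0"
    using e x T_poly_nonzero[OF k x] by (auto simp: MCM_def power_0_left)
  obtain u f where f: "f = inverse e" and Tx: "T_poly k x = u ^ 2 ^ k"
    and xu: "x = u * u ^ 2 ^ k * f"
    and eqn: "(u ^ 2 ^ k) ^ 2 ^ k * f ^ 2 ^ k + u ^ 2 ^ k + u * f = 1"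
    by (rule MCM_param[OF k x e[symmetric] \<open>e \<noteq> 0\<close>])
  obtain u' where Tx': "T_poly k x' = u' ^ 2 ^ k" and xu': "x' = u' * u' ^ 2 ^ k * f"
    and eqn': "(u' ^ 2 ^ k) ^ 2 ^ k * f ^ 2 ^ k + u' ^ 2 ^ k + u' * f = 1"
    by (rule MCM_param[OF k x' _ \<open>e \<noteq> 0\<close>]) (use e eq f in auto)
  define v where "v = u + u'"
  have u': "u' = u + v"
    by (simp add: v_def)
  have "v \<noteq> 0"
    using \<open>x \<noteq> x'\<close> xu xu' u' by auto
  define U V UU VV F where "U = u ^ 2 ^ k" and "V = v ^ 2 ^ k" and "UU = U ^ 2 ^ k"
    and "VV = V ^ 2 ^ k" and "F = f ^ 2 ^ k"
  note frob = frobenius_add power_mult_distrib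
  note folds = U_def[symmetric] V_def[symmetric] UU_def[symmetric] VV_def[symmetric]
    F_def[symmetric]
  have eqn: "UU * F + U + u * f = 1"
    using eqn by (simp add: folds)
  have eqn': "(UU + VV) * F + (U + V) + (u + v) * f = 1"
    using eqn' by (simp add: u' frob folds)
  \<comment> \<open>Adding the affine equations for \<open>u\<close> and \<open>u + v\<close> leaves
    the linear equation for the difference \<open>v\<close>.\<close>
  have "(UU * F + U + u * f) + ((UU + VV) * F + (U + V) + (u + v) * f) = 0"
    by (simp only: eqn eqn' add_self)
  then have hom: "VV * F + V + v * f = 0"
    by (simp add: algebra_simps)
  define g h where "g = (U * v + u * V) * f" and "h = v * V * f"
  have x'x: "x' = x + (g + h)"
    by (simp add: xu xu' u' g_def h_def frob folds algebra_simps)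
  have "g ^ 2 ^ k + g + V = V * (UU * F + U + u * f + 1) + U * (VV * F + V + v * f)"
    by (simp add: g_def frob folds algebra_simps)
  then have "g ^ 2 ^ k + g + V = 0"
    by (simp add: eqn hom)
  then have g: "g ^ 2 ^ k + g = V"
    by (simp add: add_eq_zero_iff)
  have "h ^ 2 ^ k + h + V\<^sup>2 = V * (VV * F + V + v * f)"
    by (simp add: h_def frob folds algebra_simps power2_eq_square)
  then have "h ^ 2 ^ k + h = V\<^sup>2"
    by (simp add: hom add_eq_zero_iff)
  \<comment> \<open>Squaring the equation for \<open>g\<close> gives the same right-hand side as for
    \<open>h\<close>, so \<open>h + g\<^sup>2\<close> is fixed by the \<open>q\<close>-th
    power.\<close>
  also have "V\<^sup>2 = (g\<^sup>2) ^ 2 ^ k + g\<^sup>2"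
    by (simp add: square_add mult.commute flip: g power_mult)
  finally have h: "h ^ 2 ^ k + h = (g\<^sup>2) ^ 2 ^ k + g\<^sup>2" .
  have "(h + g\<^sup>2) ^ 2 ^ k + (h + g\<^sup>2) = (h ^ 2 ^ k + h) + ((g\<^sup>2) ^ 2 ^ k + g\<^sup>2)"
    by (simp add: frobenius_add algebra_simps)
  then have "(h + g\<^sup>2) ^ 2 ^ k + (h + g\<^sup>2) = 0"
    by (simp only: h add_self)
  then have "(h + g\<^sup>2) ^ 2 ^ k = h + g\<^sup>2"
    by (simp only: add_eq_zero_iff)
  then consider "h + g\<^sup>2 = 1" | "h + g\<^sup>2 = 0"
    using frobenius_fixed[of k "h + g\<^sup>2"] k odd_pos[of k] by auto
  then show False
  proof cases
    case 1
    then have "g + h = (g\<^sup>2 + g) + 1"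
      by (metis add.assoc add.commute add_self_left)
    \<comment> \<open>The summand 1 contributes \<open>T_poly k 1 = 1\<close>, whereas the roots
      \<open>u\<close>, \<open>u + v\<close> force the difference of the two \<open>T_poly\<close>
      values to be \<open>V\<close>.\<close>
    then have "T_poly k (g + h) = V + 1"
      by (simp only: T_poly_add[of k "g\<^sup>2 + g" 1] T_poly_artin_schreier T_poly_one[OF k(2)] g)
    moreover have "T_poly k x' = T_poly k x + V"
      by (simp add: Tx Tx' u' frobenius_add V_def)
    ultimately show False
      by (simp add: x'x T_poly_add)
  next
    case 2
    \<comment> \<open>Here \<open>x = (y / m)\<^sup>2 + y / m\<close>, so \<open>T_k(x)\<close> can be computed; it turns out to be \<open>u ^ q + 1\<close>.\<close>
    define y m where "y = u / v" and "m = y ^ 2 ^ k + y"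
    define Y where "Y = y ^ 2 ^ k"
    have u: "u = v * y" and U: "U = V * Y"
      using \<open>v \<noteq> 0\<close> by (simp_all add: y_def Y_def U_def V_def power_divide)
    have m: "m = Y + y" and Y: "Y = m + y"
      by (simp_all add: m_def Y_def add.assoc)
    have "V \<noteq> 0" "f \<noteq> 0"
      using \<open>v \<noteq> 0\<close> \<open>e \<noteq> 0\<close> by (simp_all add: V_def f)
    have "h = g\<^sup>2"
      using 2 by (simp add: add_eq_zero_iff)
    moreover have "g = v * V * f * m"
      by (simp add: g_def u U m algebra_simps)
    ultimately have "(v * V * f) * 1 = (v * V * f) * (v * V * f * m\<^sup>2)"
      by (simp add: h_def power2_eq_square algebra_simps)
    then have vVfm: "v * V * f * m\<^sup>2 = 1"
      using \<open>v \<noteq> 0\<close> \<open>V \<noteq> 0\<close> \<open>f \<noteq> 0\<close> by simp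
    then have "m \<noteq> 0"
      by auto
    define M where "M = m ^ 2 ^ k"
    have "M \<noteq> 0"
      using \<open>m \<noteq> 0\<close> by (simp add: M_def)
    have "(v * V * f * m\<^sup>2) ^ 2 ^ k = 1"
      by (simp add: vVfm)
    then have VFM: "V * VV * F * M\<^sup>2 = 1"
      by (simp add: frob folds M_def mult.commute flip: power_mult)
    \<comment> \<open>The linear equation for \<open>v\<close>, scaled by
      \<open>V * (m * M)\<^sup>2\<close>, becomes a vanishing perfect square once
      \<open>vVfm\<close> and its \<open>q\<close>-th power \<open>VFM\<close> are used. Its square
      root is \<open>VmM\<close>.\<close>
    have "V\<^sup>2 * (m * M)\<^sup>2 + m\<^sup>2 + M\<^sup>2 = V * (m * M)\<^sup>2 * (VV * F + V + v * f)
        + m\<^sup>2 * (V * VV * F * M\<^sup>2 + 1) + M\<^sup>2 * (v * V * f * m\<^sup>2 + 1)"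
      by (simp add: algebra_simps power2_eq_square)
    also have "\<dots> = 0"
      by (simp add: vVfm VFM hom)
    finally have "(V * (m * M) + m + M)\<^sup>2 = 0"
      by (simp add: square_add power_mult_distrib)
    then have VmM: "V * m * M = m + M"
      by (simp add: add.assoc mult.assoc add_eq_zero_iff)
    have "x = u * U * f"
      by (simp add: xu folds)
    also have "\<dots> = v * V * f * (y * Y)"
      by (simp add: u U)
    also have "\<dots> = y * Y / m\<^sup>2"
      using vVfm \<open>m \<noteq> 0\<close> by (simp add: field_simps)
    also have "\<dots> = (y / m)\<^sup>2 + y / m"
      using \<open>m \<noteq> 0\<close> by (simp add: Y field_simps power2_eq_square)
    finally have "T_poly k x = (y / m) ^ 2 ^ k + y / m"
      by (simp only: T_poly_artin_schreier)
    then have "U = Y / M + y / m"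
      by (simp add: Tx power_divide U_def Y_def M_def)
    then have "V * m * M * Y = Y * m + y * M"
      using U \<open>m \<noteq> 0\<close> \<open>M \<noteq> 0\<close> by (simp add: field_simps)
    then have "(m + M) * Y = Y * m + y * M"
      by (simp add: VmM)
    \<comment> \<open>Cancelling \<open>M\<close> gives \<open>Y = y\<close>, that is
      \<open>m = 0\<close>.\<close>
    then have "M * Y = M * y"
      by (metis add_left_cancel distrib_right mult.commute)
    with \<open>M \<noteq> 0\<close> \<open>m \<noteq> 0\<close> show False
      by (simp add: m)
  qed
qed

text \<open>\<open>T_poly k\<close> has no nonzero root, so 0 is the only preimage of 0 and the
  nonzero case settles injectivity; finiteness gives the rest.\<close>

lemma MCM_bij:
  assumes "gcd k n = 1" "odd k"
  shows "bij (MCM k :: 'a \<Rightarrow> 'a)"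
proof -
  have zero: "MCM k x = 0 \<longleftrightarrow> x = 0" for x :: 'a
    using T_poly_nonzero[OF assms, of x] by (auto simp: MCM_def)
  have "inj (MCM k :: 'a \<Rightarrow> 'a)"
  proof (rule injI)
    fix x y :: 'a assume "MCM k x = MCM k y"
    then show "x = y"
      using zero[of x] zero[of y] MCM_inj_nonzero[OF assms, of x y] by metis
  qed
  then show ?thesis
    by (simp add: bij_def finite_UNIV_inj_surj)
qed

section \<open>Kasami differences as values of \<open>MCM\<close>\<close>

lemma kasami_mult:
  assumes "(b::'a) \<noteq> 0"
  shows "kasami k b = (b ^ 2 ^ k) ^ 2 ^ k * b / b ^ 2 ^ k"
proof -
  have "(4::nat) ^ k = 2 ^ k * 2 ^ k"
    by (simp flip: power_mult_distrib)
  then have "4 ^ k - 2 ^ k + 1 + 2 ^ k = 2 ^ k * 2 ^ k + (1::nat)"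
    by simp
  then have "kasami k b * b ^ 2 ^ k = b ^ (2 ^ k * 2 ^ k + 1)"
    by (metis kasami_def power_add)
  then show ?thesis
    using assms by (simp add: field_simps flip: power_mult)
qed

lemma kasami_delta_eq_MCM: "kasami_delta k b = MCM k (b\<^sup>2 + (b::'a))"
proof (cases "b = 0 \<or> b = 1")
  \<comment> \<open>Here the denominators below would vanish; both sides are 0.\<close>
  case True
  have "MCM k (0::'a) = 0"
    by (simp add: MCM_def)
  with True show ?thesis
    by (auto simp: kasami_delta_def kasami_def)
next
  case False
  then have "b + 1 \<noteq> 0"
    by (simp add: add_eq_zero_iff)
  define B C where "B = b ^ 2 ^ k" and "C = B ^ 2 ^ k"
  have B: "B \<noteq> 0" "B + 1 \<noteq> 0"
    using False \<open>b + 1 \<noteq> 0\<close> frobenius_add[of b 1 k] by (simp_all add: B_def)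
       (metis power_not_zero)
  have *: "kasami k b = C * b / B" "kasami k (b + 1) = (C + 1) * (b + 1) / (B + 1)"
    using False \<open>b + 1 \<noteq> 0\<close> by (simp_all add: kasami_mult frobenius_add B_def C_def)
  have "(b\<^sup>2 + b) ^ 2 ^ k = B\<^sup>2 + B"
    by (simp add: B_def frobenius_add mult.commute flip: power_mult)
  moreover have "T_poly k (b\<^sup>2 + b) ^ (2 ^ k + 1) = (C + B) * (B + b)"
    by (simp only: T_poly_artin_schreier power_add power_one_right frobenius_add B_def C_def)
  ultimately have "MCM k (b\<^sup>2 + b) = (C + B) * (B + b) / (B * (B + 1))"
    by (simp add: MCM_def power2_eq_square distrib_left)
  \<comment> \<open>Over the denominator \<open>B * (B + 1)\<close> the three summands are the two
    Kasami powers and the constant 1.\<close>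
  also have "(C + B) * (B + b) = C * b * (B + 1) + (C + 1) * (b + 1) * B + B * (B + 1)"
    by (simp add: algebra_simps)
  also have "\<dots> / (B * (B + 1)) = kasami_delta k b"
    using B by (simp add: kasami_delta_def * add_divide_distrib)
  finally show ?thesis ..
qed

subsection \<open>Trace and characters\<close>

lemma abs_trace_eq: "abs_trace n x = T_poly n x"
  by (simp add: abs_trace_def T_poly_def)

text \<open>The trace is idempotent, since \<open>x ^ 2 ^ n + x = 0\<close>. This makes
  \<open>chi\<close> multiplicative.\<close>

lemma T_poly_n_cases: "T_poly n (x::'a) = 0 \<or> T_poly n x = 1"
proof -
  have "(T_poly n x)\<^sup>2 = T_poly n x"
    using T_poly_square_add[of n x] by (simp add: power_card add_eq_zero_iff)
  then show ?thesis
    by (simp add: power2_eq_square)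
qed

lemma chi_0 [simp]: "chi n (0::'a) = 1"
  by (simp add: chi_def abs_trace_def power_0_left)

lemma chi_add: "chi n (x + y) = chi n x * chi n (y::'a)"
  using T_poly_n_cases[of x] T_poly_n_cases[of y]
  by (auto simp: chi_def abs_trace_eq T_poly_add)

text \<open>The fibres are the pairs \<open>{c, c + 1}\<close>.\<close>

lemma card_range_artin_schreier: "2 * card (range (\<lambda>b::'a. b\<^sup>2 + b)) = 2 ^ n"
proof -
  let ?g = "\<lambda>b::'a. b\<^sup>2 + b"
  have fibre: "card {b. ?g b = ?g c} = 2" for c
  proof -
    have "?g b = ?g c \<longleftrightarrow> b = c \<or> b = c + 1" for b
    proof -
      have "?g b = ?g c \<longleftrightarrow> ?g b + ?g c = 0"
        by (simp add: add_eq_zero_iff)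
      also have "?g b + ?g c = (b + c) * (b + (c + 1))"
        by (simp add: power2_eq_square algebra_simps)
      finally show ?thesis
        by (auto simp: add_eq_zero_iff)
    qed
    then have "{b. ?g b = ?g c} = {c, c + 1}"
      by auto
    then show ?thesis
      by simp
  qed
  have "(\<Sum>b\<in>(UNIV::'a set). 1::nat) = (\<Sum>y\<in>range ?g. \<Sum>b | b \<in> UNIV \<and> ?g b = y. 1)"
    by (rule sum.image_gen) simp
  also have "\<dots> = (\<Sum>y\<in>range ?g. 2)"
    by (rule sum.cong) (use fibre in auto)
  finally show ?thesis
    by (simp add: card_field)
qed

lemma card_trace_kernel_le: "card {x::'a. T_poly n x = 0} \<le> 2 ^ (n - 1)"
proof -
  define p :: "'a poly" where "p = (\<Sum>i<n. monom 1 (2 ^ i))"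
  \<comment> \<open>Only \<open>i = 0\<close> yields the exponent 1, so the trace polynomial is
    nonzero and its degree bounds its number of roots.\<close>
  have "coeff p 1 = (\<Sum>i<n. if i = 0 then 1 else 0)"
    unfolding p_def coeff_sum by (rule sum.cong) simp_all
  then have "p \<noteq> 0"
    using n_pos by (auto simp: sum.delta)
  moreover have "degree p \<le> 2 ^ (n - 1)"
    unfolding p_def by (rule degree_sum_le) (auto simp: degree_monom_eq)
  moreover have "poly p x = T_poly n x" for x
    by (simp add: p_def T_poly_def poly_sum poly_monom)
  ultimately show ?thesis
    using card_poly_roots_bound[of p] by simp
qed

text \<open>Additive Hilbert 90 by counting: the range lies in the kernel and already has as many
  elements as the root bound allows.\<close>

lemma trace_kernel:
  "{x::'a. T_poly n x = 0} = range (\<lambda>b. b\<^sup>2 + b)"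
  "2 * card {x::'a. T_poly n x = 0} = 2 ^ n"
proof -
  let ?R = "range (\<lambda>b::'a. b\<^sup>2 + b)"
  have "?R \<subseteq> {x. T_poly n x = 0}"
    by (auto simp: T_poly_artin_schreier power_card)
  moreover have "card {x::'a. T_poly n x = 0} \<le> card ?R"
    using card_trace_kernel_le card_range_artin_schreier n_pos by (cases n) auto
  ultimately show *: "{x::'a. T_poly n x = 0} = ?R"
    by (metis card_seteq finite)
  show "2 * card {x::'a. T_poly n x = 0} = 2 ^ n"
    unfolding * by (rule card_range_artin_schreier)
qed

lemma sum_chi: "(\<Sum>x\<in>UNIV. chi n (c * x)) = (if c = (0::'a) then 2 ^ n else 0)"
proof (cases "c = 0")
  case True
  then show ?thesis
    by (simp add: card_field)
next
  case False
  let ?K = "{x::'a. T_poly n x = 0}"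
  have "(\<Sum>x\<in>UNIV. chi n (c * x)) = (\<Sum>x\<in>UNIV. chi n (x::'a))"
    by (rule sum.reindex_bij_witness[of _ "\<lambda>x. x / c" "\<lambda>x. c * x"]) (use False in auto)
  also have "\<dots> = (\<Sum>x\<in>UNIV. 2 * of_bool (T_poly n (x::'a) = 0) - 1)"
    by (rule sum.cong) (simp_all add: chi_def abs_trace_eq)
  also have "\<dots> = real (2 * card ?K) - real (CARD('a))"
    by (simp add: sum_subtractf flip: sum_distrib_left)
  also have "\<dots> = 0"
    by (simp only: trace_kernel(2) card_field)
  finally show ?thesis
    using False by simp
qed

lemma Delta_eq: "Delta k = MCM k ` {x::'a. T_poly n x = 0}"
  by (simp add: Delta_def trace_kernel(1) image_image kasami_delta_eq_MCM)

lemma card_Delta: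
  assumes "gcd k n = 1" "odd k"
  shows "2 * card (Delta k :: 'a set) = 2 ^ n"
  unfolding Delta_eq
  by (subst card_image[OF inj_on_subset[OF bij_is_inj[OF MCM_bij[OF assms]] subset_UNIV]])
     (rule trace_kernel(2))

text \<open>Adding the vanishing sum of \<open>chi n (a * MCM k y)\<close> turns
  \<open>chi n y\<close> into \<open>1 + chi n y\<close>, twice the indicator of trace zero. At
  \<open>a = 0\<close> the two sides would be 0 and \<open>2 ^ n\<close>.\<close>

lemma walsh_MCM_eq_S_sum:
  assumes k: "gcd k n = 1" "odd k" and "(a::'a) \<noteq> 0"
  shows "walsh n (MCM k) a 1 = 2 * S_sum n k a"
proof -
  note bij = MCM_bij[OF k]
  have chi: "chi n (z + y) + chi n z = (if T_poly n y = 0 then 2 * chi n z else 0)" for y z :: 'a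
    by (simp add: chi_add chi_def[of n y] abs_trace_eq)
  have "0 = (\<Sum>x\<in>UNIV. chi n (a * x))"
    using \<open>a \<noteq> 0\<close> by (simp add: sum_chi)
  also have "\<dots> = (\<Sum>y\<in>UNIV. chi n (a * MCM k y))"
    by (rule sum.reindex_bij_betw[OF bij, symmetric])
  finally have "walsh n (MCM k) a 1
      = (\<Sum>y\<in>UNIV. chi n (a * MCM k y + y)) + (\<Sum>y\<in>UNIV. chi n (a * MCM k y))"
    by (simp add: walsh_def)
  also have "\<dots> = (\<Sum>y\<in>UNIV. if T_poly n y = 0 then 2 * chi n (a * MCM k y) else 0)"
    unfolding sum.distrib[symmetric]
    by (simp only: chi)
  also have "\<dots> = 2 * (\<Sum>y | T_poly n y = 0. chi n (a * MCM k y))"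
    by (simp add: sum.If_cases sum_distrib_left)
  also have "(\<Sum>y | T_poly n y = 0. chi n (a * MCM k y)) = S_sum n k a"
    unfolding S_sum_def Delta_eq
    by (subst sum.reindex[OF inj_on_subset[OF bij_is_inj[OF bij] subset_UNIV]]) simp
  finally show ?thesis .
qed

lemma walsh_MCM_inv:
  assumes k: "gcd k n = 1" "odd k"
  shows "walsh n (MCM_inv k) 1 (a::'a) = walsh n (MCM k) a 1"
  unfolding walsh_def MCM_inv_def
  by (subst sum.reindex_bij_betw[OF MCM_bij[OF k], symmetric])
     (simp add: inv_f_f bij_is_inj[OF MCM_bij[OF k]] add.commute)

subsection \<open>Triple correlations\<close>

text \<open>After expansion, orthogonality in \<mu> detects the linear equation. The weight
  \<open>f\<close> is left general to cover both the character values in \<open>A_sum\<close> and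
  the indicator of \<open>Delta\<close>.\<close>

lemma fourier_triple:
  fixes f :: "'a \<Rightarrow> real"
  shows "(\<Sum>\<mu>\<in>UNIV. (\<Sum>x\<in>UNIV. f x * chi n (\<mu> * a * x)) * (\<Sum>y\<in>UNIV. f y * chi n (\<mu> * b * y))
            * (\<Sum>z\<in>UNIV. f z * chi n (\<mu> * c * z)))
       = 2 ^ n * (\<Sum>(x, y, z) | a * x + b * y + c * z = 0. f x * f y * f z)"
proof -
  have expand: "sum F UNIV * sum G UNIV * sum H UNIV = (\<Sum>(x, y, z)\<in>UNIV. F x * G y * H z)"
    for F G H :: "'a \<Rightarrow> real"
    unfolding sum_product sum.cartesian_product UNIV_Times_UNIV
    by (rule sum.reindex_bij_witness[of _ "\<lambda>(x, y, z). ((x, y), z)"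
          "\<lambda>((x, y), z). (x, y, z)"]) auto
  have "(\<Sum>\<mu>\<in>UNIV. (\<Sum>x\<in>UNIV. f x * chi n (\<mu> * a * x)) * (\<Sum>y\<in>UNIV. f y * chi n (\<mu> * b * y))
            * (\<Sum>z\<in>UNIV. f z * chi n (\<mu> * c * z)))
      = (\<Sum>\<mu>\<in>UNIV. \<Sum>(x, y, z)\<in>UNIV. f x * f y * f z * chi n ((a * x + b * y + c * z) * \<mu>))"
    unfolding expand by (rule sum.cong) (auto simp: chi_add algebra_simps)
  also have "\<dots> = (\<Sum>(x, y, z)\<in>UNIV. f x * f y * f z
      * (\<Sum>\<mu>\<in>UNIV. chi n ((a * x + b * y + c * z) * \<mu>)))"
    by (subst sum.swap) (simp add: sum_distrib_left case_prod_unfold)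
  also have "\<dots> = (\<Sum>p\<in>UNIV. if p \<in> {(x, y, z). a * x + b * y + c * z = 0}
      then 2 ^ n * (case p of (x, y, z) \<Rightarrow> f x * f y * f z) else 0)"
    by (rule sum.cong) (auto simp: sum_chi)
  also have "\<dots> = 2 ^ n * (\<Sum>(x, y, z) | a * x + b * y + c * z = 0. f x * f y * f z)"
    by (simp add: sum.If_cases sum_distrib_left)
  finally show ?thesis .
qed

lemma A_sum_fourier:
  "(\<Sum>\<mu>\<in>UNIV. walsh n (MCM_inv k) 1 \<mu> * walsh n (MCM_inv k) 1 (\<mu> * \<rho>)
      * walsh n (MCM_inv k) 1 (\<mu> * (1 + \<rho>))) = 2 ^ n * A_sum n k (\<rho>::'a)"
  using fourier_triple[of "\<lambda>x. chi n (MCM_inv k x)" 1 \<rho> "1 + \<rho>"]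
  by (simp add: walsh_def A_sum_def chi_add)

lemma N_count_fourier:
  "2 ^ n * real (N_count k v w)
     = (\<Sum>\<mu>\<in>UNIV. S_sum n k (\<mu> * v) * S_sum n k (\<mu> * w) * S_sum n k (\<mu> * (v + w :: 'a)))"
proof -
  let ?f = "\<lambda>x::'a. of_bool (x \<in> Delta k) :: real"
  have S: "S_sum n k c = (\<Sum>x\<in>UNIV. ?f x * chi n (c * x))" for c :: 'a
    unfolding S_sum_def by (rule sum.mono_neutral_cong_left) auto
  have "(\<Sum>(x, y, z) | v * x + w * y + (v + w) * z = 0. ?f x * ?f y * ?f z)
      = (\<Sum>p\<in>{(x, y, z). x \<in> Delta k \<and> y \<in> Delta k \<and> z \<in> Delta k \<and>
          v * x + w * y + (v + w) * z = 0}. 1)"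
    by (rule sum.mono_neutral_cong_right) auto
  then show ?thesis
    using fourier_triple[of ?f v w "v + w"] by (simp add: S N_count_def)
qed

text \<open>Rescaling \<mu> by \<open>v\<close> normalises the coefficients to 1, \<rho>, 1 + \<rho>
  with \<open>\<rho> = w / v\<close>. The term at \<mu> = 0 is \<open>(2 ^ n / 2) ^ 3\<close>; the
  others form \<open>Z_sum\<close>.\<close>

lemma N_count_Z_sum:
  assumes k: "gcd k n = 1" "odd k" and "v \<noteq> 0"
  shows "2 ^ n * real (N_count k v w) = 2 ^ (3 * n) / 8 + Z_sum n k (w / v :: 'a)"
proof -
  let ?g = "\<lambda>\<rho> \<mu>. S_sum n k \<mu> * S_sum n k (\<mu> * \<rho>) * S_sum n k (\<mu> * (1 + \<rho> :: 'a))"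
  have S0: "S_sum n k (0::'a) = 2 ^ n / 2"
    using card_Delta[OF k] by (simp add: S_sum_def flip: of_nat_eq_iff[where 'a = real])
  have v: "v * (1 + w / v) = v + w"
    using \<open>v \<noteq> 0\<close> by (simp add: field_simps)
  have "2 ^ n * real (N_count k v w) = (\<Sum>\<mu>\<in>UNIV. ?g (w / v) \<mu>)"
    unfolding N_count_fourier
    by (rule sum.reindex_bij_witness[of _ "\<lambda>\<mu>. \<mu> / v" "\<lambda>\<mu>. \<mu> * v"])
       (use \<open>v \<noteq> 0\<close> in \<open>auto simp: mult.assoc v\<close>)
  also have "\<dots> = ?g (w / v) 0 + (\<Sum>\<mu>\<in>UNIV - {0}. ?g (w / v) \<mu>)"
    by (rule sum.remove) simp_all
  also have "UNIV - {0::'a} = {\<mu>. \<mu> \<noteq> 0}"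
    by auto
  finally show ?thesis
    by (simp add: S0 Z_sum_def power_mult power3_eq_cube power_mult_distrib mult.commute[of 3])
qed

text \<open>The term at \<mu> = 0, absent from \<open>Z_sum\<close>, vanishes on the Walsh side. For
  other \<mu> all three arguments are nonzero, and each factor contributes a 2.\<close>

lemma Z_sum_eq_A_sum:
  assumes k: "gcd k n = 1" "odd k" and \<rho>: "\<rho> \<noteq> 0" "\<rho> \<noteq> 1"
  shows "8 * Z_sum n k \<rho> = 2 ^ n * A_sum n k (\<rho>::'a)"
proof -
  let ?w = "walsh n (MCM_inv k) (1::'a)"
  have "1 + \<rho> \<noteq> 0"
    using \<rho> by (auto simp: add_eq_zero_iff)
  have "walsh n (MCM k) (0::'a) 1 = (\<Sum>x\<in>UNIV. chi n (1 * x :: 'a))"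
    by (simp add: walsh_def)
  then have w0: "walsh n (MCM k) (0::'a) 1 = 0"
    by (simp only: sum_chi) simp
  have "2 ^ n * A_sum n k \<rho> = (\<Sum>\<mu>\<in>UNIV. ?w \<mu> * ?w (\<mu> * \<rho>) * ?w (\<mu> * (1 + \<rho>)))"
    by (rule A_sum_fourier[symmetric])
  also have "\<dots> = (\<Sum>\<mu> | \<mu> \<noteq> 0. 8 * (S_sum n k \<mu> * S_sum n k (\<mu> * \<rho>) * S_sum n k (\<mu> * (1 + \<rho>))))"
    by (rule sum.mono_neutral_cong_right)
       (auto simp: w0 \<open>1 + \<rho> \<noteq> 0\<close> \<rho> walsh_MCM_inv[OF k] walsh_MCM_eq_S_sum[OF k])
  finally show ?thesis
    by (simp add: Z_sum_def flip: sum_distrib_left)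
qed

lemma N_count_iff_A_sum:
  assumes k: "gcd k n = 1" "odd k" and "2 \<le> n" and v: "v \<noteq> 0" "w \<noteq> 0" "v \<noteq> w"
  shows "N_count k v w = 2 ^ (2 * n - 3) \<longleftrightarrow> A_sum n k (w / v :: 'a) = 0"
proof -
  \<comment> \<open>\<open>2 \<le> n\<close> keeps the natural subtraction \<open>2 * n - 3\<close>
    from truncating.\<close>
  have exp: "(2::real) ^ (3 * n) = 8 * (2 ^ n * 2 ^ (2 * n - 3))"
  proof -
    have "3 * n = 3 + (n + (2 * n - 3))"
      using \<open>2 \<le> n\<close> by simp
    then have "(2::real) ^ (3 * n) = 2 ^ (3 + (n + (2 * n - 3)))"
      by (rule arg_cong)
    also have "\<dots> = 8 * (2 ^ n * 2 ^ (2 * n - 3))"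
      unfolding power_add by simp
    finally show ?thesis .
  qed
  have "N_count k v w = 2 ^ (2 * n - 3) \<longleftrightarrow> real (N_count k v w) = 2 ^ (2 * n - 3)"
    by simp
  also have "\<dots> \<longleftrightarrow> 2 ^ n * real (N_count k v w) = 2 ^ n * 2 ^ (2 * n - 3)"
    by simp
  also have "\<dots> \<longleftrightarrow> Z_sum n k (w / v) = 0"
    by (simp only: N_count_Z_sum[OF k v(1)] exp) simp
  also have "\<dots> \<longleftrightarrow> 2 ^ n * A_sum n k (w / v) = 0"
    by (subst Z_sum_eq_A_sum[OF k, symmetric]) (use v in auto)
  finally show ?thesis
    by simp
qed

text \<open>The coefficients 1, \<rho>, 1 + \<rho> sum to 0, so the solution plane is invariant
  under diagonal translation; \<open>t = t3\<close> and \<open>a = t2 + t3\<close> parametrise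
  it.\<close>

lemma A_sum_two_parameters:
  "A_sum n k (\<rho>::'a) = (\<Sum>t\<in>UNIV. \<Sum>a\<in>UNIV.
      chi n (MCM_inv k (t + \<rho> * a) + MCM_inv k (t + a) + MCM_inv k t))"
  unfolding A_sum_def sum.cartesian_product UNIV_Times_UNIV
proof (rule sum.reindex_bij_witness[of _ "\<lambda>(t, a). (t + \<rho> * a, t + a, t)"
      "\<lambda>(t1, t2, t3). (t3, t2 + t3)"], goal_cases)
  case (1 p)
  obtain t1 t2 t3 where p: "p = (t1, t2, t3)"
    by (cases p)
  have "t1 + (t3 + \<rho> * (t2 + t3)) = 0"
    using 1 by (simp add: p algebra_simps)
  then show ?case
    by (simp add: p add_eq_zero_iff ac_simps)
next
  case (5 p)
  obtain t1 t2 t3 where p: "p = (t1, t2, t3)"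
    by (cases p)
  have "t1 + (t3 + \<rho> * (t2 + t3)) = 0"
    using 5 by (simp add: p algebra_simps)
  then show ?case
    by (simp add: p add_eq_zero_iff ac_simps)
qed (auto simp: algebra_simps)

end

theorem theorem6p1:
  fixes n k :: nat
  assumes card: "CARD('a::{field, finite}) = 2 ^ n"
    and k: "1 \<le> k" "k \<le> n - 1" "gcd k n = 1" "odd k"
  shows
    "(\<forall>\<rho>::'a. \<rho> \<notin> {0, 1} \<longrightarrow>
        A_sum n k \<rho> =
          (\<Sum>t\<in>UNIV. \<Sum>a\<in>UNIV.
             chi n (MCM_inv k (t + \<rho> * a) + MCM_inv k (t + a) + MCM_inv k t)))
     \<and> (\<forall>\<rho>::'a. \<rho> \<notin> {0, 1} \<longrightarrow> 8 * Z_sum n k \<rho> = 2 ^ n * A_sum n k \<rho>)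
     \<and> ((\<forall>v1 v2 :: 'a. v1 \<noteq> 0 \<longrightarrow> v2 \<noteq> 0 \<longrightarrow> v1 \<noteq> v2 \<longrightarrow> N_count k v1 v2 = 2 ^ (2 * n - 3))
          \<longleftrightarrow> (\<forall>\<rho>::'a. \<rho> \<notin> {0, 1} \<longrightarrow> A_sum n k \<rho> = 0))
     \<and> (\<forall>\<mu>::'a. walsh n (MCM_inv k) 1 \<mu> = walsh n (MCM k) \<mu> 1)
     \<and> (\<forall>\<mu>::'a. \<mu> \<noteq> 0 \<longrightarrow> walsh n (MCM k) \<mu> 1 = 2 * S_sum n k \<mu>)
     \<and> (\<forall>\<rho>::'a. \<rho> \<notin> {0, 1} \<longrightarrow>
          A_sum n k \<rho> =
            (1 / 2 ^ n) * (\<Sum>\<mu>\<in>UNIV. walsh n (MCM_inv k) 1 \<mu> * walsh n (MCM_inv k) 1 (\<mu> * \<rho>)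
                                      * walsh n (MCM_inv k) 1 (\<mu> * (1 + \<rho>))))"
proof -
  have "2 \<le> n"
    using k by linarith
  then interpret binary_field "TYPE('a)" n
    by unfold_locales (use card in auto)
  have equiv: "(\<forall>v1 v2 :: 'a. v1 \<noteq> 0 \<longrightarrow> v2 \<noteq> 0 \<longrightarrow> v1 \<noteq> v2 \<longrightarrow> N_count k v1 v2 = 2 ^ (2 * n - 3))
      \<longleftrightarrow> (\<forall>\<rho>::'a. \<rho> \<notin> {0, 1} \<longrightarrow> A_sum n k \<rho> = 0)" (is "?N \<longleftrightarrow> ?A")
  proof
    assume N: ?N
    show ?A
    proof (intro allI impI)
      fix \<rho> :: 'a assume "\<rho> \<notin> {0, 1}"
      then show "A_sum n k \<rho> = 0"
        \<comment> \<open>The pair \<open>1\<close>, \<rho> realises the ratio \<rho>.\<close>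
        using N N_count_iff_A_sum[OF k(3,4) \<open>2 \<le> n\<close>, of 1 \<rho>] by simp
    qed
  next
    assume A: ?A
    show ?N
    proof (intro allI impI)
      fix v1 v2 :: 'a assume v: "v1 \<noteq> 0" "v2 \<noteq> 0" "v1 \<noteq> v2"
      then have "v2 / v1 \<notin> {0, 1}"
        by simp
      with A have "A_sum n k (v2 / v1) = 0"
        by blast
      then show "N_count k v1 v2 = 2 ^ (2 * n - 3)"
        by (simp only: N_count_iff_A_sum[OF k(3,4) \<open>2 \<le> n\<close> v])
    qed
  qed
  have fourier: "A_sum n k \<rho> = (1 / 2 ^ n) * (\<Sum>\<mu>\<in>UNIV. walsh n (MCM_inv k) 1 \<mu>
      * walsh n (MCM_inv k) 1 (\<mu> * \<rho>) * walsh n (MCM_inv k) 1 (\<mu> * (1 + \<rho>)))" for \<rho> :: 'a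
    by (subst A_sum_fourier) simp
  show ?thesis
    by (intro conjI allI impI equiv A_sum_two_parameters Z_sum_eq_A_sum[OF k(3,4)]
        walsh_MCM_inv[OF k(3,4)] walsh_MCM_eq_S_sum[OF k(3,4)] fourier) auto
qed

end
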